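(* For every integer $n\ge 2$, $$H_{2n+1}(q) = \sum_{k=0}^{n}(-1)^k\begin{bmatrix} n+1\\2k+1\end{bmatrix}q^{k^2-k+n-2}G_{2n-2k}(q).$$
   Context: Let $q$ be an indeterminate and $\begin{bmatrix} n\\k\end{bmatrix}$ the Gaussian $q$-binomial coefficient (equal to $0$ if $k>n\ge 0$). The $q$-Seidel triangle is the array $(g_{i,k}(q))$, $i\ge1$, determined by $g_{1,1}(q)=g_{2,1}(q)=1$, $g_{i,k}(q)=0$ if $k\le 0$ or $k>\lceil i/2\rceil$, and, for $n\ge 1$, $g_{2n,k}(q)=g_{2n,k+1}(q)+q^{k-1}g_{2n-1,k}(q)$ for $1\le k\le n$ and $g_{2n+1,k}(q)=q^{k-1}g_{2n,k}(q)+g_{2n+1,k-1}(q)$ for $1\le k\le n+1$. Define $G_{2n}(q)=g_{2n-1,n}(q)$ and $H_{2n-1}(q)=q^{n-2}g_{2n-1,1}(q)$ for $n\ge 1$; set $G_0(q)=0$ (this value occurs only with coefficient $0$). *)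

theory Defs
  imports "HOL-Computational_Algebra.Computational_Algebra"
begin

text \<open>
  Everything lives in the field of rational functions in one indeterminate over the
  integers, so that \<open>H\<^sub>1 = q\<^sup>-\<^sup>1\<close> and the quotients defining the
  Gaussian coefficients make literal sense.
\<close>

type_synonym qrat = "int poly fract"

definition qvar :: qrat where
  "qvar = to_fract (monom 1 1)"

definition qbinom :: "nat \<Rightarrow> nat \<Rightarrow> qrat" where
  "qbinom n k =
     (if k > n then 0 else (\<Prod>i=1..k. (1 - qvar ^ (n - i + 1)) / (1 - qvar ^ i)))"

text \<open>
  Rows start at \<open>1\<close>; row \<open>0\<close> is a dummy. The integer \<open>(i + 1) div 2\<close> is the
  ceiling of \<open>i / 2\<close>.
\<close>

function seidel :: "nat \<Rightarrow> int \<Rightarrow> qrat" where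
  "seidel i k =
     (if i = 0 \<or> k \<le> 0 \<or> k > (int i + 1) div 2 then 0
      else if i = 1 \<or> i = 2 then 1
      else if even i then seidel i (k + 1) + qvar powi (k - 1) * seidel (i - 1) k
      else qvar powi (k - 1) * seidel (i - 1) k + seidel i (k - 1))"
  by pat_completeness auto
termination
  by (relation "measures [fst, \<lambda>(i, k). if even i then nat ((int i + 1) div 2 + 1 - k) else nat k]")
     auto

declare seidel.simps [simp del]

lemma seidel_outside:
  assumes "k \<le> 0 \<or> k > \<lceil>real i / 2\<rceil>"
  shows "seidel i k = 0"
proof -
  have "\<lceil>real i / 2\<rceil> = (int i + 1) div 2"
    by (rule ceiling_unique) linarith+
  with assms show ?thesis by (subst seidel.simps) auto
qed

lemma seidel_init: "seidel 1 1 = 1" "seidel 2 1 = 1"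
  by (subst seidel.simps; simp)+

lemma seidel_even:
  assumes "n \<ge> 1" "1 \<le> k" "k \<le> int n"
  shows "seidel (2 * n) k = seidel (2 * n) (k + 1) + qvar powi (k - 1) * seidel (2 * n - 1) k"
proof (cases "n = 1")
  case True
  with assms have "k = 1" by simp
  with True show ?thesis by (simp add: seidel.simps)
next
  case False
  with assms show ?thesis by (subst seidel.simps) auto
qed

lemma seidel_odd:
  assumes "n \<ge> 1" "1 \<le> k" "k \<le> int n + 1"
  shows "seidel (2 * n + 1) k = qvar powi (k - 1) * seidel (2 * n) k + seidel (2 * n + 1) (k - 1)"
  using assms by (subst seidel.simps) auto

text \<open>
  \<open>Gnum m\<close> and \<open>Hnum m\<close> are meant for even and for odd \<open>m\<close> only, respectively:
  \<open>Gnum (2 * n)\<close> is the entry \<open>(2n - 1, n)\<close>, and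
  \<open>Hnum (2 * n - 1)\<close> is \<open>q\<^sup>n\<^sup>-\<^sup>2\<close> times the entry \<open>(2n - 1, 1)\<close>.
\<close>

definition Gnum :: "nat \<Rightarrow> qrat" where
  "Gnum m = (if m = 0 then 0 else seidel (m - 1) (int m div 2))"

definition Hnum :: "nat \<Rightarrow> qrat" where
  "Hnum m = qvar powi ((int m + 1) div 2 - 2) * seidel m 1"

lemma Gnum_even: "n \<ge> 1 \<Longrightarrow> Gnum (2 * n) = seidel (2 * n - 1) (int n)"
  by (simp add: Gnum_def)

lemma Hnum_odd: "n \<ge> 1 \<Longrightarrow> Hnum (2 * n - 1) = qvar powi (int n - 2) * seidel (2 * n - 1) 1"
  by (simp add: Hnum_def of_nat_diff)

end

(*
  Read each row from its right end: a_n(j) = g_{2n+1,n+1-j} and b_n(j) = g_{2n,n+1-j}.  The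
  defining recurrences become
    a_n(j+1) = a_n(j) - q^(n-j) b_n(j),   b_n(j+1) = b_n(j) + q^(n-j-1) a_{n-1}(j),
  with a_n(0) = G_{2n+2} and b_n(0) = 0.  By the q-Pascal rule they are solved by signed sums of
  q-binomial coefficients [j,2k] (for a) and [j,2k+1] (for b) times values of G.  Since
  g_{2n+1,1} = g_{2n,1} = b_n(n), and the entry a_{n-1}(n) = g_{2n-1,0} vanishes, the solution
  for b may be continued one step further, to j = n+1, which gives the coefficients [n+1,2k+1].
*)
theory Submission
  imports Defs
begin

lemma qvar_nonzero [simp]: "qvar \<noteq> 0"
  by (simp add: qvar_def monom_eq_0_iff)

text \<open>Otherwise a monomial of degree \<open>i > 0\<close> would equal 1. This allows the
  denominators of the Gaussian coefficients to be cancelled.\<close>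

lemma one_minus_qvar_power_nonzero: "i \<noteq> 0 \<Longrightarrow> 1 - qvar ^ i \<noteq> 0"
proof
  assume "i \<noteq> 0" "1 - qvar ^ i = 0"
  have power: "qvar ^ i = to_fract (monom 1 i)"
    by (induction i) (simp_all add: qvar_def mult_monom flip: to_fract_mult)
  have "monom (1 :: int) i = 1"
    using \<open>1 - qvar ^ i = 0\<close> power by (metis eq_iff_diff_eq_0 to_fract_1 to_fract_eq_iff)
  with \<open>i \<noteq> 0\<close> show False
    by (metis degree_1 degree_monom_eq one_neq_zero)
qed

lemma qbinom_0_right [simp]: "qbinom n 0 = 1"
  by (simp add: qbinom_def)

lemma qbinom_0_left [simp]: "qbinom 0 (Suc k) = 0"
  by (simp add: qbinom_def)

text \<open>No bound on \<open>k\<close> is required: for \<open>k = n\<close> the factor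
  \<open>1 - qvar ^ 0\<close> is zero, and for \<open>k > n\<close> both coefficients are
  zero.\<close>

lemma qbinom_Suc_right:
  "qbinom n (Suc k) = qbinom n k * ((1 - qvar ^ (n - k)) / (1 - qvar ^ Suc k))"
proof (cases "k < n")
  case True
  then have "n - Suc k + 1 = n - k" by simp
  with True show ?thesis by (simp add: qbinom_def del: power_Suc)
qed (auto simp: qbinom_def)

lemma qbinom_Suc_Suc_quotient:
  "qbinom (Suc n) (Suc k) = qbinom n k * ((1 - qvar ^ Suc n) / (1 - qvar ^ Suc k))"
proof (induction k)
  case 0
  show ?case by (simp add: qbinom_Suc_right)
next
  case (Suc k)
  show ?case
    using one_minus_qvar_power_nonzero[of "Suc k"] one_minus_qvar_power_nonzero[of "Suc (Suc k)"]
    by (subst qbinom_Suc_right, subst Suc.IH)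
       (simp add: qbinom_Suc_right[of n] field_simps del: power_Suc)
qed

text \<open>Written as multiples of \<open>qbinom n k\<close>, the three coefficients reduce the
  rule to the identity \<open>*\<close> below; for \<open>k > n\<close> all of them vanish.\<close>

lemma qbinom_Pascal:
  "qbinom (Suc n) (Suc k) = qvar ^ Suc k * qbinom n (Suc k) + qbinom n k"
proof (cases "k \<le> n")
  case True
  have "qvar ^ Suc k * qvar ^ (n - k) = qvar ^ Suc n"
    using True by (simp flip: power_add)
  then have *: "1 - qvar ^ Suc n = qvar ^ Suc k * (1 - qvar ^ (n - k)) + (1 - qvar ^ Suc k)"
    by (simp add: algebra_simps)
  show ?thesis
    using one_minus_qvar_power_nonzero[of "Suc k"]
    unfolding qbinom_Suc_Suc_quotient unfolding qbinom_Suc_right *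
    by (simp add: field_simps del: power_Suc)
qed (simp add: qbinom_def)

text \<open>Candidate closed form for a_n(j). The exponent is an integer because
  \<open>j = n + 1\<close>, one step past the row, is used as well.\<close>

definition odd_row :: "nat \<Rightarrow> nat \<Rightarrow> qrat" where
  "odd_row n j = (\<Sum>k\<le>n. (-1) ^ k * qbinom j (2 * k)
     * qvar powi (int k ^ 2 + int k + 2 * int k * (int n - int j)) * Gnum (2 * n + 2 - 2 * k))"

text \<open>Candidate closed form for b_n(j). The sum stops before \<open>k = n\<close>, where the
  factor would be G_0 = 0.\<close>

definition even_row :: "nat \<Rightarrow> nat \<Rightarrow> qrat" where
  "even_row n j = (\<Sum>k<n. (-1) ^ k * qbinom j (2 * k + 1)
     * qvar powi (int k ^ 2 - int k - 1 + (2 * int k + 1) * (int n + 1 - int j))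
     * Gnum (2 * n - 2 * k))"

text \<open>The factor \<open>qvar ^ Suc m\<close> of the q-Pascal rule is absorbed into the
  exponent, so that the rule applies termwise to the row sums.\<close>

lemma qbinom_Pascal_powi:
  assumes "e' + int (Suc m) = e"
  shows "qbinom (Suc j) (Suc m) * qvar powi e'
    = qbinom j (Suc m) * qvar powi e + qbinom j m * qvar powi e'"
  unfolding qbinom_Pascal assms[symmetric] power_int_add[OF disjI1[OF qvar_nonzero]] power_int_of_nat
  by (simp add: algebra_simps)

lemma odd_row_0: "odd_row n 0 = Gnum (2 * n + 2)"
proof -
  have "odd_row n 0 = (\<Sum>k\<le>n. if k = 0 then Gnum (2 * n + 2) else 0)"
    unfolding odd_row_def
    by (intro sum.cong refl) (auto simp: qbinom_def)
  then show ?thesis by simp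
qed

lemma even_row_0: "even_row n 0 = 0"
  by (simp add: even_row_def)

lemma odd_row_Suc:
  "odd_row n (Suc j) = odd_row n j - qvar powi (int n - int j) * even_row n j"
proof -
  define c where "c k = (-1) ^ k * Gnum (2 * n - 2 * k)" for k
  define e where "e i k = int k ^ 2 + int k + 2 * int k * (int n - int i)" for i k
  define d where "d k = int k ^ 2 - int k - 1 + (2 * int k + 1) * (int n + 1 - int j)" for k
  \<comment> \<open>The first identity is the hypothesis of \<open>qbinom_Pascal_powi\<close>; the
    second matches the remaining Pascal term with a term of \<open>even_row n j\<close>.\<close>
  have exps: "e (Suc j) (Suc k) + int (Suc (2 * k + 1)) = e j (Suc k)"
    "e (Suc j) (Suc k) = (int n - int j) + d k" for k
    by (simp_all add: e_def d_def algebra_simps power2_eq_square)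
  \<comment> \<open>The term \<open>k = 0\<close> does not depend on \<open>i\<close>. Shifting the
    index in the others makes the lower entry a successor and produces the minus sign.\<close>
  have odd: "odd_row n i = Gnum (2 * n + 2)
      - (\<Sum>k<n. c k * (qbinom i (Suc (2 * k + 1)) * qvar powi e i (Suc k)))" for i
  proof -
    have "odd_row n i
        = (\<Sum>k<Suc n. (-1) ^ k * qbinom i (2 * k) * qvar powi e i k * Gnum (2 * n + 2 - 2 * k))"
      by (simp only: odd_row_def e_def lessThan_Suc_atMost)
    also have "\<dots> = Gnum (2 * n + 2)
        - (\<Sum>k<n. c k * (qbinom i (Suc (2 * k + 1)) * qvar powi e i (Suc k)))"
      unfolding sum.lessThan_Suc_shift
      by (simp add: e_def[of i 0] c_def sum_negf mult_ac)
    finally show ?thesis .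
  qed
  have "qvar powi (int n - int j) * even_row n j
      = (\<Sum>k<n. c k * (qbinom j (2 * k + 1) * qvar powi e (Suc j) (Suc k)))"
    unfolding even_row_def sum_distrib_left exps(2) d_def[symmetric]
      power_int_add[OF disjI1[OF qvar_nonzero]]
    by (simp add: c_def mult_ac)
  then show ?thesis
    unfolding odd qbinom_Pascal_powi[OF exps(1)]
    by (simp add: distrib_left sum.distrib)
qed

lemma even_row_Suc:
  "even_row (Suc n) (Suc j) = even_row (Suc n) j + qvar powi (int n - int j) * odd_row n j"
proof -
  define c where "c k = (-1) ^ k * Gnum (2 * n + 2 - 2 * k)" for k
  define e where
    "e i k = int k ^ 2 - int k - 1 + (2 * int k + 1) * (int (Suc n) + 1 - int i)" for i k
  define d where "d k = int k ^ 2 + int k + 2 * int k * (int n - int j)" for k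
  have exps: "e (Suc j) k + int (Suc (2 * k)) = e j k"
    "e (Suc j) k = (int n - int j) + d k" for k
    by (simp_all add: e_def d_def algebra_simps power2_eq_square)
  have even: "even_row (Suc n) i
      = (\<Sum>k\<le>n. c k * (qbinom i (Suc (2 * k)) * qvar powi e i k))" for i
    unfolding even_row_def lessThan_Suc_atMost e_def[symmetric]
    by (simp add: c_def mult_ac)
  have "qvar powi (int n - int j) * odd_row n j
      = (\<Sum>k\<le>n. c k * (qbinom j (2 * k) * qvar powi e (Suc j) k))"
    unfolding odd_row_def sum_distrib_left exps(2) d_def[symmetric]
      power_int_add[OF disjI1[OF qvar_nonzero]]
    by (simp add: c_def mult_ac)
  then show ?thesis
    unfolding even qbinom_Pascal_powi[OF exps(1)]
    by (simp add: distrib_left sum.distrib)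
qed

text \<open>
  The exception \<open>n = 0\<close>, \<open>j = 1\<close> is genuine: row 1 does not satisfy the odd recurrence at its
  only entry, as \<open>seidel 1 0 = 0\<close> but \<open>odd_row 0 1 = 1\<close>.
\<close>

lemma seidel_eq_rows:
  "(j \<le> n \<or> j = Suc n \<and> n \<ge> 1 \<longrightarrow> seidel (2 * n + 1) (int n + 1 - int j) = odd_row n j) \<and>
   (j \<le> n \<and> n \<ge> 1 \<longrightarrow> seidel (2 * n) (int n + 1 - int j) = even_row n j)"
\<comment> \<open>An entry of row \<open>2 * n\<close> depends on row \<open>2 * n - 1\<close>,
  which belongs to \<open>n - 1\<close>; hence \<open>n\<close> is generalized.\<close>
proof (induction j arbitrary: n)
  case 0
  have "seidel (2 * n) (int n + 1) = 0"
    by (subst seidel.simps) auto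
  moreover have "Gnum (2 * n + 2) = seidel (2 * n + 1) (int n + 1)"
    by (simp add: Gnum_def add.commute)
  ultimately show ?case by (simp add: odd_row_0 even_row_0)
next
  case (Suc j)
  have odd: "seidel (2 * n + 1) (int n + 1 - int (Suc j)) = odd_row n (Suc j)"
    if "j \<le> n" "n \<ge> 1"
  proof -
    have "int n + 1 - int (Suc j) = int n + 1 - int j - 1" by simp
    then show ?thesis
      using seidel_odd[of n "int n + 1 - int j"] Suc.IH[of n] that
      by (simp add: odd_row_Suc)
  qed
  have even: "seidel (2 * n) (int n + 1 - int (Suc j)) = even_row n (Suc j)"
    if "Suc j \<le> n"
  proof -
    obtain m where m: "n = Suc m" using \<open>Suc j \<le> n\<close> by (cases n) auto
    show ?thesis
      using seidel_even[of n "int n - int j"] Suc.IH[of n] Suc.IH[of m] that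
      by (simp add: m even_row_Suc algebra_simps)
  qed
  show ?case using odd even by auto
qed

theorem mainTheorem9:
  fixes n :: nat
  assumes "n \<ge> 2"
  shows "Hnum (2 * n + 1) =
    (\<Sum>k=0..n. (-1) ^ k * qbinom (n + 1) (2 * k + 1)
       * qvar powi (int k ^ 2 - int k + int n - 2) * Gnum (2 * n - 2 * k))"
proof -
  obtain m where m: "n = Suc m" "m \<ge> 1"
    using assms by (cases n) auto
  \<comment> \<open>This is the case one step past the row, \<open>j = Suc m\<close>; it requires
    \<open>m \<ge> 1\<close>, that is, \<open>n \<ge> 2\<close>.\<close>
  have "odd_row m n = seidel (2 * m + 1) 0"
    using seidel_eq_rows[of n m] m by simp
  also have "\<dots> = 0"
    by (subst seidel.simps) simp
  finally have odd_row_end: "odd_row m n = 0" .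
  have "seidel (2 * n + 1) 1 = seidel (2 * n) 1 + seidel (2 * n + 1) 0"
    using seidel_odd[of n 1] assms by simp
  also have "seidel (2 * n + 1) 0 = 0"
    by (subst seidel.simps) simp
  also have "seidel (2 * n) 1 = even_row n n"
    using seidel_eq_rows[of n n] assms by simp
  \<comment> \<open>\<open>even_row_Suc\<close> holds for all \<open>j\<close>; here its correction
    term is a multiple of \<open>odd_row m n = 0\<close>.\<close>
  also have "even_row n n = even_row n (Suc n)"
    using even_row_Suc[of m n] odd_row_end m by simp
  finally have "Hnum (2 * n + 1) = qvar powi (int n - 1) * even_row n (Suc n)"
    by (simp add: Hnum_def)
  also have "\<dots> = (\<Sum>k<n. (-1) ^ k * qbinom (n + 1) (2 * k + 1)
       * qvar powi (int k ^ 2 - int k + int n - 2) * Gnum (2 * n - 2 * k))"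
    unfolding even_row_def sum_distrib_left
  proof (intro sum.cong refl)
    fix k
    \<comment> \<open>At \<open>j = Suc n\<close> the summand
      \<open>(2 * int k + 1) * (int n + 1 - int j)\<close> of the exponent vanishes.\<close>
    have "int k ^ 2 - int k + int n - 2 = (int n - 1) + (int k ^ 2 - int k - 1)" by simp
    then have "qvar powi (int k ^ 2 - int k + int n - 2)
        = qvar powi (int n - 1) * qvar powi (int k ^ 2 - int k - 1)"
      by (simp only: power_int_add[OF disjI1[OF qvar_nonzero]])
    then show "qvar powi (int n - 1) * ((-1) ^ k * qbinom (Suc n) (2 * k + 1)
        * qvar powi (int k ^ 2 - int k - 1 + (2 * int k + 1) * (int n + 1 - int (Suc n)))
        * Gnum (2 * n - 2 * k))
      = (-1) ^ k * qbinom (n + 1) (2 * k + 1)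
        * qvar powi (int k ^ 2 - int k + int n - 2) * Gnum (2 * n - 2 * k)"
      by (simp add: mult_ac)
  qed
  \<comment> \<open>The added term \<open>k = n\<close> is zero because
    \<open>Gnum 0 = 0\<close>.\<close>
  also have "\<dots> = (\<Sum>k=0..n. (-1) ^ k * qbinom (n + 1) (2 * k + 1)
       * qvar powi (int k ^ 2 - int k + int n - 2) * Gnum (2 * n - 2 * k))"
    by (simp add: atLeast0AtMost lessThan_Suc_atMost[symmetric] Gnum_def)
  finally show ?thesis .
qed

end
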